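(* Let $p\ge 5$ be a prime and let $\chi$ be a generator of the group $\widehat{\mathbb{F}_p^{\times}}$ of multiplicative characters of $\mathbb{F}_p$. Then $$\det\left[J_p(\chi^{2i},\chi^{2j})\right]_{1\le i,j\le (p-3)/2}=\frac{1+(-1)^{\frac{p+1}{2}}p}{4}\left(\frac{p-1}{2}\right)^{\frac{p-5}{2}}.$$
   Context: Multiplicative characters $\psi:\mathbb{F}_p^\times\to\mathbb{C}^\times$ are extended to $\mathbb{F}_p$ by $\psi(0)=0$. The Jacobi sum is $J_p(\chi^i,\chi^j):=\sum_{x\in\mathbb{F}_p}\chi^i(x)\chi^j(1-x)$. *)

theory Defs
  imports
    Complex_Main
    "HOL-Number_Theory.Residues"
    "HOL-Algebra.Generated_Groups"
    "Jordan_Normal_Form.Determinant"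
begin

definition complex_units :: "complex monoid"
  where "complex_units = \<lparr>carrier = UNIV - {0}, monoid.mult = (*), one = 1\<rparr>"

abbreviation Fp :: "nat \<Rightarrow> int ring"
  where "Fp p \<equiv> residue_ring (int p)"

(* The dual group of the multiplicative group of the field with p elements.  Its elements are
   total functions on int; each character, the trivial one included, is extended by 0 to the
   zero residue (and to all integers outside the carrier {0..<p} of the residue ring, so that
   functions agreeing on the nonzero residues are equal).  Powers taken in this group are
   therefore characters already extended by 0. *)
definition char_group :: "nat \<Rightarrow> (int \<Rightarrow> complex) monoid"
  where "char_group p =
    \<lparr>carrier = {\<psi>. \<psi> \<in> hom (mult_of (Fp p)) complex_units \<and>
                   (\<forall>x. x \<notin> carrier (mult_of (Fp p)) \<longrightarrow> \<psi> x = 0)},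
     monoid.mult = (\<lambda>\<phi> \<psi> x. \<phi> x * \<psi> x),
     one = (\<lambda>x. if x \<in> carrier (mult_of (Fp p)) then 1 else 0)\<rparr>"

definition jacobi_sum :: "nat \<Rightarrow> (int \<Rightarrow> complex) \<Rightarrow> (int \<Rightarrow> complex) \<Rightarrow> complex"
  where "jacobi_sum p \<phi> \<psi> = (\<Sum>x\<in>carrier (Fp p). \<phi> x * \<psi> (\<one>\<^bsub>Fp p\<^esub> \<ominus>\<^bsub>Fp p\<^esub> x))"

lemma comm_group_char_group:
  assumes "prime p"
  shows "comm_group (char_group p)"
proof -
  interpret residues_prime p "Fp p"
    using assms by unfold_locales auto
  interpret M: group "mult_of (Fp p)"
    by (rule field_mult_group)
  show ?thesis
  proof (rule comm_groupI)
    fix \<phi> \<psi>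
    assume "\<phi> \<in> carrier (char_group p)" "\<psi> \<in> carrier (char_group p)"
    then show "\<phi> \<otimes>\<^bsub>char_group p\<^esub> \<psi> \<in> carrier (char_group p)"
      by (auto simp: char_group_def complex_units_def hom_def Pi_iff)
  next
    show "\<one>\<^bsub>char_group p\<^esub> \<in> carrier (char_group p)"
      using M.m_closed by (auto simp: char_group_def complex_units_def hom_def)
  next
    fix \<phi>
    assume \<phi>: "\<phi> \<in> carrier (char_group p)"
    have "(\<lambda>x. inverse (\<phi> x)) \<in> carrier (char_group p)"
      using \<phi> by (auto simp: char_group_def complex_units_def hom_def Pi_iff)
    moreover have "(\<lambda>x. inverse (\<phi> x)) \<otimes>\<^bsub>char_group p\<^esub> \<phi> = \<one>\<^bsub>char_group p\<^esub>"
      using \<phi> by (auto simp: char_group_def complex_units_def hom_def Pi_iff fun_eq_iff)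
    ultimately show "\<exists>\<psi>\<in>carrier (char_group p). \<psi> \<otimes>\<^bsub>char_group p\<^esub> \<phi> = \<one>\<^bsub>char_group p\<^esub>"
      by blast
  qed (auto simp: char_group_def mult_ac fun_eq_iff)
qed

end

theory Submission
  imports Defs "HOL-Number_Theory.Residue_Primitive_Roots"
begin

text \<open>
  Put \<open>p = 2 * n + 1\<close>, let \<open>G \<alpha>\<close> be the Gauss sum of \<open>\<alpha>\<close> and \<open>\<psi> = \<chi>\<^sup>2\<close>.  For \<open>1 \<le> i, j < n\<close> one has,
  also when \<open>i + j = n\<close>,
  \<open>G (\<psi> ^ i) * G (\<psi> ^ j) * G (\<psi> ^ - (i + j)) = p * J (\<psi> ^ i) (\<psi> ^ j)\<close>, and
  \<open>G (\<psi> ^ i) * G (\<psi> ^ - i) = p\<close>.  Pulling the factors \<open>G (\<psi> ^ i)\<close> and \<open>G (\<psi> ^ j)\<close> out of rows and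
  columns leaves the matrix of the \<open>G (\<psi> ^ - (i + j))\<close>.  As \<open>\<psi>\<close> is even,
  \<open>G (\<psi> ^ - (i + j)) = (\<Sum>a = 1..n. \<psi> a ^ - i * \<psi> a ^ - j * \<theta> a)\<close> with
  \<open>\<theta> a = \<zeta> ^ a + \<zeta> ^ - a\<close>, a Gram matrix with respect to the orthogonal rows
  \<open>a \<mapsto> \<psi> a ^ - i\<close> from which the row \<open>i = 0\<close> is missing.  Its determinant is
  \<open>\<plusminus> n ^ (n - 2) * (\<Prod>a. \<theta> a) * (\<Sum>a. 1 / \<theta> a)\<close>, where \<open>\<Prod>a. \<theta> a = \<plusminus> 1\<close> and
  \<open>(\<Sum>a. 1 / \<theta> a) = ((- 1) ^ n * p - 1) / 4\<close>.
\<close>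

section \<open>Determinants\<close>

text \<open>Each permutation in the Leibniz expansion meets every row and every column exactly once.
  This later pulls the Gauss sums out of the Jacobi matrix and the weights out of a weighted
  one.\<close>

lemma det_mat_scale_rows_cols:
  "det (mat n n (\<lambda>(i, j). c i * d j * f i j)) =
     (\<Prod>i<n. c i) * (\<Prod>j<n. d j) * det (mat n n (\<lambda>(i, j). f i j))"
  for c d :: "nat \<Rightarrow> 'a :: comm_ring_1"
proof -
  have *: "(\<Prod>i = 0..<n. mat n n (\<lambda>(i, j). c i * d j * f i j) $$ (i, \<pi> i)) =
      (\<Prod>i<n. c i) * (\<Prod>j<n. d j) * (\<Prod>i = 0..<n. mat n n (\<lambda>(i, j). f i j) $$ (i, \<pi> i))"
    if \<pi>: "\<pi> permutes {0..<n}" for \<pi>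
  proof -
    have "(\<Prod>i = 0..<n. mat n n (\<lambda>(i, j). c i * d j * f i j) $$ (i, \<pi> i)) =
        (\<Prod>i = 0..<n. c i) * (\<Prod>i = 0..<n. d (\<pi> i)) * (\<Prod>i = 0..<n. f i (\<pi> i))"
      unfolding prod.distrib [symmetric] using \<pi>
      by (intro prod.cong) (auto simp: permutes_in_image [OF \<pi>])
    also have "(\<Prod>i = 0..<n. d (\<pi> i)) = (\<Prod>j = 0..<n. d j)"
      using prod.permute [OF \<pi>, of d] by (simp add: o_def)
    also have "(\<Prod>i = 0..<n. f i (\<pi> i)) = (\<Prod>i = 0..<n. mat n n (\<lambda>(i, j). f i j) $$ (i, \<pi> i))"
      using \<pi> by (intro prod.cong) (auto simp: permutes_in_image [OF \<pi>])
    finally show ?thesis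
      by (simp only: atLeast0LessThan)
  qed
  show ?thesis
    unfolding det_def' [OF mat_carrier] sum_distrib_left
  proof (rule sum.cong [OF refl])
    fix \<pi> assume "\<pi> \<in> {\<pi>. \<pi> permutes {0..<n}}"
    then show "signof \<pi> * (\<Prod>i = 0..<n. mat n n (\<lambda>(i, j). c i * d j * f i j) $$ (i, \<pi> i)) =
        (\<Prod>i<n. c i) * (\<Prod>j<n. d j) *
        (signof \<pi> * (\<Prod>i = 0..<n. mat n n (\<lambda>(i, j). f i j) $$ (i, \<pi> i)))"
      by (simp only: mem_Collect_eq * mult.left_commute)
  qed
qed

text \<open>The first row has its only nonzero entry in the last column, so Laplace expansion
  contributes the sign \<open>(- 1) ^ n\<close> at each step; these signs add up to a triangular
  exponent.\<close>

lemma det_anti_diagonal: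
  "det (mat n n (\<lambda>(i, j). if i + j + 1 = n then c else 0)) = (- 1) ^ (n * (n - 1) div 2) * c ^ n"
  for c :: "'a :: comm_ring_1"
proof (induction n)
  case (Suc n)
  let ?A = "\<lambda>n. mat n n (\<lambda>(i, j). if i + j + 1 = n then c else 0)"
  have "det (?A (Suc n)) = (\<Sum>j<Suc n. ?A (Suc n) $$ (0, j) * cofactor (?A (Suc n)) 0 j)"
    by (rule laplace_expansion_row) auto
  also have "\<dots> = (\<Sum>j<Suc n. if j = n then c * cofactor (?A (Suc n)) 0 j else 0)"
    by (intro sum.cong) auto
  also have "\<dots> = c * cofactor (?A (Suc n)) 0 n"
    by simp
  also have "mat_delete (?A (Suc n)) 0 n = ?A n"
    by (rule eq_matI) (auto simp: mat_delete_def)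
  then have "cofactor (?A (Suc n)) 0 n = (- 1) ^ n * det (?A n)"
    by (simp add: cofactor_def)
  also have "c * ((- 1) ^ n * det (?A n)) = (- 1) ^ (n + n * (n - 1) div 2) * c ^ Suc n"
    by (simp only: Suc.IH power_add power_Suc mult_ac)
  also have "n + n * (n - 1) div 2 = Suc n * (Suc n - 1) div 2"
    by (cases n) (auto simp: algebra_simps)
  finally show ?case .
qed simp

lemma det_first_row:
  fixes f :: "nat \<Rightarrow> nat \<Rightarrow> 'a :: comm_ring_1"
  assumes "\<And>j. 0 < j \<Longrightarrow> j \<le> n \<Longrightarrow> f 0 j = 0"
  shows "det (mat (Suc n) (Suc n) (\<lambda>(i, j). f i j)) =
           f 0 0 * det (mat n n (\<lambda>(i, j). f (Suc i) (Suc j)))"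
proof -
  let ?A = "mat (Suc n) (Suc n) (\<lambda>(i, j). f i j)"
  have "det ?A = (\<Sum>j<Suc n. ?A $$ (0, j) * cofactor ?A 0 j)"
    by (rule laplace_expansion_row) auto
  also have "\<dots> = (\<Sum>j<Suc n. if j = 0 then f 0 0 * cofactor ?A 0 0 else 0)"
    using assms by (intro sum.cong) auto
  also have "\<dots> = f 0 0 * cofactor ?A 0 0"
    by simp
  also have "mat_delete ?A 0 0 = mat n n (\<lambda>(i, j). f (Suc i) (Suc j))"
    by (rule eq_matI) (auto simp: mat_delete_def)
  then have "cofactor ?A 0 0 = det (mat n n (\<lambda>(i, j). f (Suc i) (Suc j)))"
    by (simp add: cofactor_def)
  finally show ?thesis .
qed

lemma det_first_column:
  fixes f :: "nat \<Rightarrow> nat \<Rightarrow> 'a :: comm_ring_1"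
  assumes "\<And>i. 0 < i \<Longrightarrow> i \<le> n \<Longrightarrow> f i 0 = 0"
  shows "det (mat (Suc n) (Suc n) (\<lambda>(i, j). f i j)) =
           f 0 0 * det (mat n n (\<lambda>(i, j). f (Suc i) (Suc j)))"
proof -
  have tr: "det (mat k k (\<lambda>(i, j). g i j)) = det (mat k k (\<lambda>(i, j). g j i))"
    for k and g :: "nat \<Rightarrow> nat \<Rightarrow> 'a"
  proof -
    have "transpose_mat (mat k k (\<lambda>(i, j). g i j)) = mat k k (\<lambda>(i, j). g j i)"
      by (rule eq_matI) auto
    then show ?thesis
      by (metis det_transpose mat_carrier)
  qed
  show ?thesis
    using assms by (subst (1 2) tr) (rule det_first_row, auto)
qed

lemma mat_mult_mat_eq:
  "mat n n (\<lambda>(i, j). f i j) * mat n n (\<lambda>(i, j). g i j) = mat n n (\<lambda>(i, j). \<Sum>a<n. f i a * g a j)"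
  by (rule eq_matI) (auto simp: scalar_prod_def atLeast0LessThan)

text \<open>The rows of \<open>w\<close> with index at least 1, weighted by \<open>\<theta>\<close> and completed by the row that is
  dual to \<open>w 0\<close>, turn the minor into a full determinant.  Dividing the weights out again moves them
  to the completing row, where only the pairing with \<open>w 0\<close> matters.\<close>

lemma det_weighted_gram:
  fixes w :: "nat \<Rightarrow> nat \<Rightarrow> 'a :: field" and \<theta> :: "nat \<Rightarrow> 'a"
  assumes orth: "\<And>i j. i < Suc m \<Longrightarrow> j < Suc m \<Longrightarrow>
      (\<Sum>a<Suc m. w i a * w j a) = (if Suc m dvd i + j then of_nat (Suc m) else 0)"
    and w0: "\<And>a. a < Suc m \<Longrightarrow> w 0 a = 1"
    and \<theta>: "\<And>a. a < Suc m \<Longrightarrow> \<theta> a \<noteq> 0"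
  shows "of_nat (Suc m) * det (mat m m (\<lambda>(i, j). \<Sum>a<Suc m. w (Suc i) a * w (Suc j) a * \<theta> a)) =
           (- 1) ^ (m * (m - 1) div 2) * of_nat (Suc m) ^ m *
           (\<Prod>a<Suc m. \<theta> a) * (\<Sum>a<Suc m. inverse (\<theta> a))"
proof -
  let ?n = "Suc m" and ?N = "of_nat (Suc m) :: 'a"
  \<comment> \<open>Row 0 becomes the constant row \<open>w 0\<close> once the columns are
    multiplied by \<open>\<theta>\<close>. The factor 1 in \<open>R'\<close> only matches the shape
    expected by \<open>det_mat_scale_rows_cols\<close>.\<close>
  define r where "r i a = (if i = 0 then inverse (\<theta> a) else w i a)" for i a
  define W where "W = mat ?n ?n (\<lambda>(a, j). w j a)"
  define R where "R = mat ?n ?n (\<lambda>(i, a). r i a)"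
  define R' where "R' = mat ?n ?n (\<lambda>(i, a). 1 * \<theta> a * r i a)"
  let ?D = "det (mat m m (\<lambda>(i, j). \<Sum>a<?n. w (Suc i) a * w (Suc j) a * \<theta> a))"
  \<comment> \<open>The sum lies strictly between 0 and \<open>2 * ?n\<close>, so the only possible
    multiple is \<open>?n\<close> itself.\<close>
  have dvd_iff: "?n dvd Suc i + Suc j \<longleftrightarrow> i + j + 1 = m" if "i < m" "j < m" for i j
  proof
    assume "?n dvd Suc i + Suc j"
    then obtain k where k: "Suc i + Suc j = ?n * k"
      by (elim dvdE)
    with that have "?n * k < ?n * 2"
      by simp
    then have "k < 2"
      by (simp only: mult_less_cancel1)
    with k have "k = 1"
      by (cases k) auto
    with k show "i + j + 1 = m"
      by simp
  qed auto
  have scale: "det R' = (\<Prod>a<?n. \<theta> a) * det R"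
    unfolding R'_def R_def by (subst det_mat_scale_rows_cols) simp
  \<comment> \<open>Without weights, rows 1 to m are orthogonal to \<open>w 0\<close>, so column 0
    of the product vanishes below its top entry. The remaining block is anti-diagonal.\<close>
  have RW: "det R * det W = (\<Sum>a<?n. inverse (\<theta> a)) * ((- 1) ^ (m * (m - 1) div 2) * ?N ^ m)"
  proof -
    have "det R * det W = det (R * W)"
      by (rule det_mult [symmetric]) (auto simp: R_def W_def)
    also have "R * W = mat ?n ?n (\<lambda>(i, j). \<Sum>a<?n. r i a * w j a)"
      unfolding R_def W_def by (rule mat_mult_mat_eq)
    also have "det \<dots> = (\<Sum>a<?n. r 0 a * w 0 a) *
        det (mat m m (\<lambda>(i, j). \<Sum>a<?n. r (Suc i) a * w (Suc j) a))"
    proof (rule det_first_column)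
      fix i assume i: "0 < i" "i \<le> m"
      then have "(\<Sum>a<?n. w i a * w 0 a) = 0"
        using orth [of i 0] by (auto dest: dvd_imp_le)
      then show "(\<Sum>a<?n. r i a * w 0 a) = 0"
        using i by (simp add: r_def)
    qed
    also have "(\<Sum>a<?n. r 0 a * w 0 a) = (\<Sum>a<?n. inverse (\<theta> a))"
      by (intro sum.cong) (auto simp: r_def w0)
    also have "mat m m (\<lambda>(i, j). \<Sum>a<?n. r (Suc i) a * w (Suc j) a) =
        mat m m (\<lambda>(i, j). if i + j + 1 = m then ?N else 0)"
    proof (rule eq_matI)
      fix i j
      assume "i < dim_row (mat m m (\<lambda>(i, j). if i + j + 1 = m then ?N else 0))"
        and "j < dim_col (mat m m (\<lambda>(i, j). if i + j + 1 = m then ?N else 0))"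
      then have ij: "i < m" "j < m"
        by simp_all
      then have "(\<Sum>a<?n. r (Suc i) a * w (Suc j) a) = (if i + j + 1 = m then ?N else 0)"
        using orth [of "Suc i" "Suc j"] dvd_iff [of i j]
        by (simp only: r_def nat.simps if_False Suc_less_eq refl)
      with ij show "mat m m (\<lambda>(i, j). \<Sum>a<?n. r (Suc i) a * w (Suc j) a) $$ (i, j) =
          mat m m (\<lambda>(i, j). if i + j + 1 = m then ?N else 0) $$ (i, j)"
        by (simp only: index_mat prod.case)
    qed (simp_all only: dim_row_mat dim_col_mat)
    also have "det \<dots> = (- 1) ^ (m * (m - 1) div 2) * ?N ^ m"
      by (rule det_anti_diagonal)
    finally show ?thesis .
  qed
  \<comment> \<open>With weights, row 0 is \<open>w 0\<close>, so now row 0 of the product vanishes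
    after its first entry, and the remaining block is the wanted Gram matrix.\<close>
  have R'W: "det R' * det W = ?N * ?D"
  proof -
    have "det R' * det W = det (R' * W)"
      by (rule det_mult [symmetric]) (auto simp: R'_def W_def)
    also have "R' * W = mat ?n ?n (\<lambda>(i, j). \<Sum>a<?n. 1 * \<theta> a * r i a * w j a)"
      unfolding R'_def W_def by (rule mat_mult_mat_eq)
    also have "det \<dots> = (\<Sum>a<?n. 1 * \<theta> a * r 0 a * w 0 a) *
        det (mat m m (\<lambda>(i, j). \<Sum>a<?n. 1 * \<theta> a * r (Suc i) a * w (Suc j) a))"
    proof (rule det_first_row)
      fix j assume j: "0 < j" "j \<le> m"
      then have "(\<Sum>a<?n. w 0 a * w j a) = 0"
        using orth [of 0 j] by (auto dest: dvd_imp_le)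
      moreover have "(\<Sum>a<?n. 1 * \<theta> a * r 0 a * w j a) = (\<Sum>a<?n. w 0 a * w j a)"
        using \<theta> by (intro sum.cong) (auto simp: r_def w0)
      ultimately show "(\<Sum>a<?n. 1 * \<theta> a * r 0 a * w j a) = 0"
        by simp
    qed
    also have "(\<Sum>a<?n. 1 * \<theta> a * r 0 a * w 0 a) = (\<Sum>a<?n. 1)"
      using \<theta> by (intro sum.cong) (auto simp: r_def w0)
    also have "\<dots> = ?N"
      by (simp only: sum_constant card_lessThan mult_1_right)
    also have "(\<lambda>(i, j). \<Sum>a<?n. 1 * \<theta> a * r (Suc i) a * w (Suc j) a) =
        (\<lambda>(i, j). \<Sum>a<?n. w (Suc i) a * w (Suc j) a * \<theta> a)"
      by (simp add: r_def mult_ac fun_eq_iff del: sum.lessThan_Suc)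
    finally show ?thesis .
  qed
  show ?thesis
    unfolding R'W [symmetric] scale by (simp only: RW mult.assoc) (simp only: mult_ac)
qed

section \<open>Multiplicative characters\<close>

text \<open>Characters are taken here as periodic functions on all integers, so that arguments such
  as \<open>- 1\<close>, \<open>u * x\<close> and \<open>1 - x\<close> need no reduction into
  \<open>{0..<int p}\<close>, unlike in \<open>char_group\<close>.\<close>

definition mult_char :: "nat \<Rightarrow> (int \<Rightarrow> complex) \<Rightarrow> bool" where
  "mult_char p \<alpha> \<longleftrightarrow> (\<forall>x y. \<alpha> (x * y) = \<alpha> x * \<alpha> y) \<and> (\<forall>x. \<alpha> (x mod int p) = \<alpha> x) \<and>
     (\<forall>x. \<alpha> x = 0 \<longleftrightarrow> int p dvd x)"

lemma mult_char_mult: "mult_char p \<alpha> \<Longrightarrow> \<alpha> (x * y) = \<alpha> x * \<alpha> y"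
  and mult_char_mod: "mult_char p \<alpha> \<Longrightarrow> \<alpha> (x mod int p) = \<alpha> x"
  and mult_char_eq_0_iff: "mult_char p \<alpha> \<Longrightarrow> \<alpha> x = 0 \<longleftrightarrow> int p dvd x"
  by (auto simp: mult_char_def)

lemma mult_char_prod: "mult_char p \<alpha> \<Longrightarrow> mult_char p \<beta> \<Longrightarrow> mult_char p (\<lambda>x. \<alpha> x * \<beta> x)"
  by (simp add: mult_char_def)

text \<open>The convention \<open>inverse 0 = 0\<close> preserves the extension by zero.\<close>

lemma mult_char_inverse: "mult_char p \<alpha> \<Longrightarrow> mult_char p (\<lambda>x. inverse (\<alpha> x))"
  by (simp add: mult_char_def)

lemma mult_char_power: "mult_char p \<alpha> \<Longrightarrow> k > 0 \<Longrightarrow> mult_char p (\<lambda>x. \<alpha> x ^ k)"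
  by (simp add: mult_char_def power_mult_distrib)

section \<open>Substitution and folding in sums and products over residues\<close>

lemma coprime_of_prime_int: "prime p \<Longrightarrow> \<not> int p dvd x \<Longrightarrow> coprime x (int p)"
  using prime_imp_coprime [of "int p" x] by (simp add: coprime_commute)

lemma bij_betw_affine_mod:
  fixes c d :: int
  assumes "coprime c (int p)" "p > 0"
  shows "bij_betw (\<lambda>x. (c * x + d) mod int p) {0..<int p} {0..<int p}"
proof -
  have inj: "inj_on (\<lambda>x. (c * x + d) mod int p) {0..<int p}"
  proof (rule inj_onI)
    fix x y assume xy: "x \<in> {0..<int p}" "y \<in> {0..<int p}"
    assume "(c * x + d) mod int p = (c * y + d) mod int p"
    then have "[c * x = c * y] (mod int p)"
      by (simp add: cong_def [symmetric] cong_add_rcancel)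
    then have "[x = y] (mod int p)"
      using assms by (simp add: cong_mult_lcancel)
    then show "x = y"
      using xy by (simp add: cong_def)
  qed
  moreover have "(\<lambda>x. (c * x + d) mod int p) ` {0..<int p} \<subseteq> {0..<int p}"
    using assms by auto
  ultimately show ?thesis
    by (simp add: bij_betw_def endo_inj_surj)
qed

text \<open>The change of variable behind the orthogonality relations and the rescaling of Gauss
  sums; periodicity absorbs the reduction modulo p.\<close>

lemma sum_affine_periodic:
  fixes c d :: int
  assumes "coprime c (int p)" "p > 0" "\<And>x. f (x mod int p) = f x"
  shows "(\<Sum>x\<in>{0..<int p}. f (c * x + d)) = (\<Sum>x\<in>{0..<int p}. f x)"
  using sum.reindex_bij_betw [OF bij_betw_affine_mod [OF assms(1,2)], of f d] by (simp add: assms(3))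

text \<open>Scaling by a unit fixes 0, hence also permutes the nonzero residues.\<close>

lemma prod_scale_periodic:
  fixes c :: int
  assumes "coprime c (int p)" "p > 0" "\<And>x. f (x mod int p) = f x"
  shows "(\<Prod>x\<in>{1..<int p}. f (c * x)) = (\<Prod>x\<in>{1..<int p}. f x)"
proof -
  have bij: "bij_betw (\<lambda>x. (c * x + 0) mod int p) {0..<int p} {0..<int p}"
    using assms by (intro bij_betw_affine_mod)
  have "bij_betw (\<lambda>x. (c * x + 0) mod int p) ({0..<int p} - {0}) ({0..<int p} - {(c * 0 + 0) mod int p})"
    using assms(2) by (intro bij_betw_DiffI bij) (auto simp: bij_betw_def)
  moreover have "{0..<int p} - {0} = {1..<int p}"
    by auto
  ultimately have "bij_betw (\<lambda>x. c * x mod int p) {1..<int p} {1..<int p}"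
    by simp
  from prod.reindex_bij_betw [OF this, of f] show ?thesis
    by (simp add: assms(3))
qed

text \<open>Every nonzero residue modulo an odd number is x or its negative for a unique x from 1 to
  n; the index \<open>a\<close> starts at 0, whence \<open>Suc a\<close>.\<close>

lemma atLeastLessThan_int_halves:
  "{1..<int (2 * n + 1)} =
     (\<lambda>a. int (Suc a)) ` {..<n} \<union> (\<lambda>a. int (2 * n + 1) - int (Suc a)) ` {..<n}"
proof (intro equalityI subsetI)
  fix x assume x: "x \<in> {1..<int (2 * n + 1)}"
  show "x \<in> (\<lambda>a. int (Suc a)) ` {..<n} \<union> (\<lambda>a. int (2 * n + 1) - int (Suc a)) ` {..<n}"
  proof (cases "x \<le> int n")
    case True
    with x show ?thesis
      by (intro UnI1 image_eqI [of _ _ "nat (x - 1)"]) auto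
  next
    case False
    with x show ?thesis
      by (intro UnI2 image_eqI [of _ _ "nat (int (2 * n) - x)"]) auto
  qed
qed auto

lemma sum_fold_half:
  fixes f :: "int \<Rightarrow> 'a :: comm_monoid_add"
  shows "(\<Sum>x\<in>{1..<int (2 * n + 1)}. f x) =
           (\<Sum>a<n. f (int (Suc a)) + f (int (2 * n + 1) - int (Suc a)))"
proof -
  have "(\<Sum>x\<in>{1..<int (2 * n + 1)}. f x) = (\<Sum>x\<in>(\<lambda>a. int (Suc a)) ` {..<n}. f x) +
      (\<Sum>x\<in>(\<lambda>a. int (2 * n + 1) - int (Suc a)) ` {..<n}. f x)"
    unfolding atLeastLessThan_int_halves by (intro sum.union_disjoint) auto
  also have "\<dots> = (\<Sum>a<n. f (int (Suc a))) + (\<Sum>a<n. f (int (2 * n + 1) - int (Suc a)))"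
    by (intro arg_cong2 [where f = "(+)"]; subst sum.reindex) (auto simp: inj_on_def)
  finally show ?thesis
    by (simp only: sum.distrib)
qed

lemma prod_fold_half:
  fixes f :: "int \<Rightarrow> 'a :: comm_monoid_mult"
  shows "(\<Prod>x\<in>{1..<int (2 * n + 1)}. f x) =
           (\<Prod>a<n. f (int (Suc a)) * f (int (2 * n + 1) - int (Suc a)))"
proof -
  have "(\<Prod>x\<in>{1..<int (2 * n + 1)}. f x) = (\<Prod>x\<in>(\<lambda>a. int (Suc a)) ` {..<n}. f x) *
      (\<Prod>x\<in>(\<lambda>a. int (2 * n + 1) - int (Suc a)) ` {..<n}. f x)"
    unfolding atLeastLessThan_int_halves by (intro prod.union_disjoint) auto
  also have "\<dots> = (\<Prod>a<n. f (int (Suc a))) * (\<Prod>a<n. f (int (2 * n + 1) - int (Suc a)))"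
    by (intro arg_cong2 [where f = "(*)"]; subst prod.reindex) (auto simp: inj_on_def)
  finally show ?thesis
    by (simp only: prod.distrib)
qed

text \<open>Replacing x by \<open>u * x\<close> multiplies the sum by \<open>\<alpha> u\<close>,
  which differs from 1.\<close>

lemma sum_mult_char_eq_0:
  assumes "mult_char p \<alpha>" "prime p" "\<not> int p dvd u" "\<alpha> u \<noteq> 1"
  shows "(\<Sum>x\<in>{0..<int p}. \<alpha> x) = 0"
proof -
  have "coprime u (int p)"
    using assms by (simp add: coprime_of_prime_int)
  then have "(\<Sum>x\<in>{0..<int p}. \<alpha> (u * x + 0)) = (\<Sum>x\<in>{0..<int p}. \<alpha> x)"
    using assms by (intro sum_affine_periodic) (auto simp: mult_char_mod prime_gt_0_nat)
  then have "\<alpha> u * (\<Sum>x\<in>{0..<int p}. \<alpha> x) = (\<Sum>x\<in>{0..<int p}. \<alpha> x)"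
    using assms by (simp add: mult_char_mult sum_distrib_left)
  with assms(4) show ?thesis
    by simp
qed

lemma mult_char_1: "mult_char p \<alpha> \<Longrightarrow> prime p \<Longrightarrow> \<alpha> 1 = 1"
  using mult_char_mult [of p \<alpha> 1 1] mult_char_eq_0_iff [of p \<alpha> 1] by auto

lemma mult_char_power_arg: "mult_char p \<alpha> \<Longrightarrow> prime p \<Longrightarrow> \<alpha> (x ^ k) = \<alpha> x ^ k"
  by (induction k) (simp_all add: mult_char_1 mult_char_mult)

text \<open>Fermat's little theorem, transported along \<open>\<alpha>\<close> by
  periodicity.\<close>

lemma mult_char_order:
  assumes "mult_char p \<alpha>" "prime p" "\<not> int p dvd x"
  shows "\<alpha> x ^ (p - 1) = 1"
proof -
  define a where "a = nat (x mod int p)"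
  have a: "int a = x mod int p"
    using assms(2) by (simp add: a_def prime_gt_0_nat)
  then have "\<not> p dvd a"
    using assms(3) by (metis dvd_mod_iff int_dvd_int_iff dvd_refl)
  with assms(2) have "[a ^ (p - 1) = 1] (mod p)"
    by (rule fermat_theorem)
  then have "[int a ^ (p - 1) = 1] (mod int p)"
    by (metis cong_int_iff of_nat_1 of_nat_power)
  then have "\<alpha> (int a ^ (p - 1)) = \<alpha> 1"
    using assms(1) by (metis cong_def mult_char_mod)
  then show ?thesis
    using assms by (simp add: mult_char_power_arg mult_char_1 a mult_char_mod)
qed

lemma mult_char_reflect:
  assumes "mult_char p \<alpha>" "\<alpha> (- 1) = 1"
  shows "\<alpha> (int p - x) = \<alpha> x"
  using mult_char_mod [OF assms(1), of "int p - x"] mult_char_mod [OF assms(1), of "- x"]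
    mult_char_mult [OF assms(1), of "- 1" x] assms(2) by simp

lemma sum_mult_char_eq_sum_nonzero:
  assumes "mult_char p \<alpha>" "p > 0"
  shows "(\<Sum>x\<in>{0..<int p}. \<alpha> x) = (\<Sum>x\<in>{1..<int p}. \<alpha> x)"
proof -
  have "{0..<int p} = insert 0 {1..<int p}"
    using assms(2) by auto
  moreover have "\<alpha> 0 = 0"
    using assms(1) by (simp add: mult_char_eq_0_iff)
  ultimately show ?thesis
    by simp
qed

section \<open>Gauss sums\<close>

text \<open>A nontrivial additive character modulo p, given only by additivity and its kernel. The
  choice of a root of unity is postponed until a sign has to be determined.\<close>

locale additive_char =
  fixes p :: nat and e :: "int \<Rightarrow> complex"
  assumes prime: "prime p"
    and e_add: "e (x + y) = e x * e y"
    and e_eq_1_iff: "e x = 1 \<longleftrightarrow> int p dvd x"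
begin

lemma p_pos: "p > 0"
  using prime by (rule prime_gt_0_nat)

lemma coprime_p: "\<not> int p dvd x \<Longrightarrow> coprime x (int p)"
  using prime by (rule coprime_of_prime_int)

lemma e_mod: "e (x mod int p) = e x"
proof -
  have "e x = e (x mod int p + int p * (x div int p))"
    by simp
  also have "\<dots> = e (x mod int p) * e (int p * (x div int p))"
    by (rule e_add)
  also have "e (int p * (x div int p)) = 1"
    by (simp add: e_eq_1_iff)
  finally show ?thesis
    by simp
qed

lemma e_0 [simp]: "e 0 = 1"
  by (simp add: e_eq_1_iff)

lemma e_neq_0 [simp]: "e x \<noteq> 0"
proof
  assume "e x = 0"
  then have "e (x + - x) = 0"
    by (simp only: e_add mult_zero_left)
  then show False
    by simp
qed

lemma e_minus: "e (- x) = inverse (e x)"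
  using e_add [of x "- x"] by (simp add: field_simps)

lemma e_power: "e x ^ k = e (int k * x)"
  by (induction k) (simp_all add: e_add algebra_simps)

text \<open>If p does not divide k, shifting x by 1 multiplies the sum by \<open>e k\<close>, which
  is not 1.\<close>

lemma sum_e: "(\<Sum>x\<in>{0..<int p}. e (k * x)) = (if int p dvd k then of_nat p else 0)"
proof (cases "int p dvd k")
  case True
  then have "e (k * x) = 1" for x
    by (simp add: e_eq_1_iff)
  with True show ?thesis
    by simp
next
  case False
  have "(\<Sum>x\<in>{0..<int p}. e (k * (1 * x + 1))) = (\<Sum>x\<in>{0..<int p}. e (k * x))"
    using p_pos by (intro sum_affine_periodic) (auto simp: e_mod [of "k * _", symmetric] mod_simps)
  then have "e k * (\<Sum>x\<in>{0..<int p}. e (k * x)) = (\<Sum>x\<in>{0..<int p}. e (k * x))"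
    by (simp add: distrib_left e_add sum_distrib_left mult_ac)
  with False show ?thesis
    by (simp add: e_eq_1_iff)
qed

definition gauss_sum :: "(int \<Rightarrow> complex) \<Rightarrow> complex" where
  "gauss_sum \<alpha> = (\<Sum>x\<in>{0..<int p}. \<alpha> x * e x)"

lemma sum_e_nonzero:
  "(\<Sum>x\<in>{1..<int p}. e (k * x)) = (if int p dvd k then of_nat p else 0) - 1"
proof -
  have "{0..<int p} = insert 0 {1..<int p}"
    using p_pos by auto
  with sum_e [of k] show ?thesis
    by (simp add: algebra_simps split: if_splits)
qed

text \<open>Substitute \<open>z * x\<close> for x. This lets character values at z cancel when a
  product of Gauss sums is expanded over z.\<close>

lemma mult_char_times_gauss_sum:
  assumes "mult_char p \<alpha>" "\<not> int p dvd z"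
  shows "gauss_sum \<alpha> = \<alpha> z * (\<Sum>x\<in>{0..<int p}. \<alpha> x * e (z * x))"
proof -
  have "(\<Sum>x\<in>{0..<int p}. \<alpha> (z * x + 0) * e (z * x + 0)) = gauss_sum \<alpha>"
    unfolding gauss_sum_def using assms p_pos coprime_p
    by (intro sum_affine_periodic [where f = "\<lambda>x. \<alpha> x * e x"]) (auto simp: mult_char_mod e_mod)
  then show ?thesis
    using assms by (simp add: mult_char_mult sum_distrib_left mult_ac)
qed

lemma gauss_sum_eq_nonzero:
  assumes "mult_char p \<alpha>"
  shows "gauss_sum \<alpha> = (\<Sum>x\<in>{1..<int p}. \<alpha> x * e x)"
proof -
  have "{0..<int p} = insert 0 {1..<int p}"
    using p_pos by auto
  moreover have "\<alpha> 0 = 0"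
    using assms by (simp add: mult_char_eq_0_iff)
  ultimately show ?thesis
    by (simp add: gauss_sum_def)
qed

lemma not_dvd_of_mem: "z \<in> {1..<int p} \<Longrightarrow> \<not> int p dvd z"
  using zdvd_not_zless by auto

text \<open>The bracket is the value of \<open>sum_e_nonzero\<close> at \<open>c + x\<close>. Its
  first part selects the residue of \<open>- c\<close>; its constant part vanishes by
  \<open>sum0\<close>. Both product formulas for Gauss sums end this way.\<close>

lemma sum_mult_char_shift:
  assumes \<alpha>: "mult_char p \<alpha>" and sum0: "(\<Sum>x\<in>{0..<int p}. \<alpha> x) = 0"
  shows "(\<Sum>x\<in>{0..<int p}. \<alpha> x * ((if int p dvd c + x then of_nat p else 0) - 1)) = of_nat p * \<alpha> (- c)"
proof -
  have dvd: "int p dvd c + x \<longleftrightarrow> x = (- c) mod int p" if "x \<in> {0..<int p}" for x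
  proof -
    have "int p dvd c + x \<longleftrightarrow> [x = - c] (mod int p)"
      by (simp add: cong_iff_dvd_diff add.commute)
    with that show ?thesis
      by (simp add: cong_def)
  qed
  have "(\<Sum>x\<in>{0..<int p}. \<alpha> x * ((if int p dvd c + x then of_nat p else 0) - 1)) =
      (\<Sum>x\<in>{0..<int p}. (if x = (- c) mod int p then of_nat p * \<alpha> x else 0) - \<alpha> x)"
    by (intro sum.cong) (simp_all add: dvd right_diff_distrib)
  also have "\<dots> = of_nat p * \<alpha> ((- c) mod int p)"
    using p_pos by (simp add: sum_subtractf sum0)
  finally show ?thesis
    using \<alpha> by (simp add: mult_char_mod)
qed

text \<open>Expand the second factor over z, rescale the first by z so that the values at z cancel,
  and then sum over z first.\<close>

lemma gauss_sum_times_inverse: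
  assumes \<alpha>: "mult_char p \<alpha>" and sum0: "(\<Sum>x\<in>{0..<int p}. \<alpha> x) = 0"
  shows "gauss_sum \<alpha> * gauss_sum (\<lambda>x. inverse (\<alpha> x)) = of_nat p * \<alpha> (- 1)"
proof -
  have "gauss_sum \<alpha> * gauss_sum (\<lambda>x. inverse (\<alpha> x)) =
      (\<Sum>z\<in>{1..<int p}. gauss_sum \<alpha> * (inverse (\<alpha> z) * e z))"
    by (subst gauss_sum_eq_nonzero [of "\<lambda>x. inverse (\<alpha> x)"])
      (simp_all add: mult_char_inverse \<alpha> sum_distrib_left)
  also have "\<dots> = (\<Sum>z\<in>{1..<int p}. \<Sum>x\<in>{0..<int p}. \<alpha> x * e ((1 + x) * z))"
  proof (intro sum.cong refl)
    fix z assume "z \<in> {1..<int p}"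
    then have z: "\<not> int p dvd z"
      by (rule not_dvd_of_mem)
    then have "\<alpha> z \<noteq> 0"
      using \<alpha> by (simp add: mult_char_eq_0_iff)
    moreover have "e ((1 + x) * z) = e (z * x) * e z" for x
      by (simp add: e_add [symmetric] algebra_simps)
    moreover from \<open>\<alpha> z \<noteq> 0\<close> have "gauss_sum \<alpha> * (inverse (\<alpha> z) * e z) =
        (\<Sum>x\<in>{0..<int p}. \<alpha> x * e (z * x)) * e z"
      by (simp add: mult_char_times_gauss_sum [OF \<alpha> z] field_simps)
    ultimately show "gauss_sum \<alpha> * (inverse (\<alpha> z) * e z) = (\<Sum>x\<in>{0..<int p}. \<alpha> x * e ((1 + x) * z))"
      by (simp add: sum_distrib_left mult_ac)
  qed
  also have "\<dots> = (\<Sum>x\<in>{0..<int p}. \<alpha> x * ((if int p dvd 1 + x then of_nat p else 0) - 1))"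
    by (subst sum.swap) (simp add: sum_distrib_left [symmetric] sum_e_nonzero)
  also have "\<dots> = of_nat p * \<alpha> (- 1)"
    using \<alpha> sum0 by (rule sum_mult_char_shift)
  finally show ?thesis .
qed

text \<open>The same argument with z running through the third factor and the other two rescaled.
  The product of the characters may be trivial, in which case the third Gauss sum is -1; this covers
  \<open>i + j = n\<close> in the matrix.\<close>

lemma gauss_sum_triple:
  assumes \<alpha>: "mult_char p \<alpha>" and \<alpha>0: "(\<Sum>x\<in>{0..<int p}. \<alpha> x) = 0"
    and \<beta>: "mult_char p \<beta>" and \<beta>0: "(\<Sum>x\<in>{0..<int p}. \<beta> x) = 0"
    and even: "\<alpha> (- 1) = 1" "\<beta> (- 1) = 1"
  shows "gauss_sum \<alpha> * gauss_sum \<beta> * gauss_sum (\<lambda>x. inverse (\<alpha> x * \<beta> x)) =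
           of_nat p * (\<Sum>x\<in>{0..<int p}. \<alpha> x * \<beta> (1 - x))"
proof -
  let ?\<delta> = "\<lambda>k. (if int p dvd k then of_nat p else 0) - 1 :: complex"
  have \<gamma>: "mult_char p (\<lambda>x. inverse (\<alpha> x * \<beta> x))"
    using \<alpha> \<beta> by (intro mult_char_inverse mult_char_prod)
  have "gauss_sum \<alpha> * gauss_sum \<beta> * gauss_sum (\<lambda>x. inverse (\<alpha> x * \<beta> x)) =
      (\<Sum>z\<in>{1..<int p}. gauss_sum \<alpha> * gauss_sum \<beta> * (inverse (\<alpha> z * \<beta> z) * e z))"
    by (subst gauss_sum_eq_nonzero [OF \<gamma>]) (simp add: sum_distrib_left)
  also have "\<dots> = (\<Sum>z\<in>{1..<int p}. \<Sum>x\<in>{0..<int p}. \<Sum>y\<in>{0..<int p}.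
      \<alpha> x * \<beta> y * e ((1 + x + y) * z))"
  proof (intro sum.cong refl)
    fix z assume "z \<in> {1..<int p}"
    then have z: "\<not> int p dvd z"
      by (rule not_dvd_of_mem)
    then have "\<alpha> z \<noteq> 0" "\<beta> z \<noteq> 0"
      using \<alpha> \<beta> by (simp_all add: mult_char_eq_0_iff)
    then have "gauss_sum \<alpha> * gauss_sum \<beta> * (inverse (\<alpha> z * \<beta> z) * e z) =
        (\<Sum>x\<in>{0..<int p}. \<alpha> x * e (z * x)) * (\<Sum>y\<in>{0..<int p}. \<beta> y * e (z * y)) * e z"
      by (simp add: mult_char_times_gauss_sum [OF \<alpha> z] mult_char_times_gauss_sum [OF \<beta> z] field_simps)
    also have "\<dots> = (\<Sum>x\<in>{0..<int p}. \<Sum>y\<in>{0..<int p}. \<alpha> x * \<beta> y * e ((1 + x + y) * z))"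
    proof -
      have "e ((1 + x + y) * z) = e (z * x) * e (z * y) * e z" for x y
        by (simp add: e_add [symmetric] algebra_simps)
      then show ?thesis
        unfolding sum_product unfolding sum_distrib_right by (simp only: mult_ac)
    qed
    finally show "gauss_sum \<alpha> * gauss_sum \<beta> * (inverse (\<alpha> z * \<beta> z) * e z) =
        (\<Sum>x\<in>{0..<int p}. \<Sum>y\<in>{0..<int p}. \<alpha> x * \<beta> y * e ((1 + x + y) * z))" .
  qed
  also have "\<dots> = (\<Sum>x\<in>{0..<int p}. \<Sum>y\<in>{0..<int p}. \<Sum>z\<in>{1..<int p}.
      \<alpha> x * \<beta> y * e ((1 + x + y) * z))"
    by (subst sum.swap, rule sum.cong [OF refl], rule sum.swap)
  also have "\<dots> = (\<Sum>x\<in>{0..<int p}. \<alpha> x * (\<Sum>y\<in>{0..<int p}. \<beta> y * ?\<delta> (1 + x + y)))"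
    by (simp only: sum_distrib_left [symmetric] sum_e_nonzero mult.assoc)
  also have "\<dots> = (\<Sum>x\<in>{0..<int p}. \<alpha> x * (of_nat p * \<beta> (- (1 + x))))"
    by (simp only: sum_mult_char_shift [OF \<beta> \<beta>0])
  \<comment> \<open>Evenness of \<open>\<beta>\<close> removes the sign here; evenness of
    \<open>\<alpha>\<close> then allows replacing x by \<open>- x\<close> to reach
    \<open>1 - x\<close>.\<close>
  also have "\<dots> = of_nat p * (\<Sum>x\<in>{0..<int p}. \<alpha> x * \<beta> (1 + x))"
  proof -
    have "\<beta> (- (1 + x)) = \<beta> (1 + x)" for x
      using mult_char_mult [OF \<beta>, of "- 1" "1 + x"] even by simp
    then show ?thesis
      by (simp only: sum_distrib_left mult.left_commute)
  qed
  also have "(\<Sum>x\<in>{0..<int p}. \<alpha> x * \<beta> (1 + x)) =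
      (\<Sum>x\<in>{0..<int p}. \<alpha> (- 1 * x + 0) * \<beta> (1 + (- 1 * x + 0)))"
    using p_pos
    by (intro sum_affine_periodic [symmetric, where f = "\<lambda>x. \<alpha> x * \<beta> (1 + x)"])
      (auto simp: mult_char_mod [OF \<alpha>] mult_char_mod [OF \<beta>, of "1 + _", symmetric] mod_simps)
  also have "\<dots> = (\<Sum>x\<in>{0..<int p}. \<alpha> x * \<beta> (1 - x))"
    using mult_char_mult [OF \<alpha>, of "- 1"] even by simp
  finally show ?thesis .
qed

section \<open>The weights \<open>e x + e (- x)\<close>: nonvanishing, sum of reciprocals,
  product\<close>

lemma e_plus_e_minus_neq_0:
  assumes "odd p"
  shows "e x + e (- x) \<noteq> 0"
proof
  assume "e x + e (- x) = 0"
  \<comment> \<open>So \<open>e x\<close> would have order 4, impossible for a p-th root of unity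
    with p odd.\<close>
  then have "e x * e x = - 1"
    by (simp add: e_minus field_simps add_eq_0_iff)
  then have "e (4 * x) = 1"
    using e_power [of x 4] by (simp add: power4_eq_xxxx)
  then have "int p dvd 4 * x"
    by (simp add: e_eq_1_iff)
  moreover have "coprime (int p) 4"
    using \<open>odd p\<close> coprime_power_right_iff [of "int p" 2 2] by simp
  ultimately have "int p dvd x"
    by (simp add: coprime_dvd_mult_right_iff)
  then have "e x = 1"
    by (simp add: e_eq_1_iff)
  with \<open>e x * e x = - 1\<close> show False
    by simp
qed

text \<open>With q denoting \<open>e (2 * x)\<close>, multiplying the weight by \<open>e x\<close>
  gives 1 + q. The geometric sum in -q then yields 1 - (-q)^p = 2, as p is odd and q^p = 1.\<close>

lemma inverse_e_plus_e_minus: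
  assumes "odd p"
  shows "inverse (e x + e (- x)) = (\<Sum>k<p. (- 1) ^ k * e ((2 * int k + 1) * x)) / 2"
proof -
  have "(e x + e (- x)) * (\<Sum>k<p. (- 1) ^ k * e ((2 * int k + 1) * x)) =
      (e x + e (- x)) * e x * (\<Sum>k<p. (- e (2 * x)) ^ k)"
  proof -
    have "e ((2 * int k + 1) * x) = e x * e (2 * x) ^ k" for k
      by (simp add: e_power e_add [symmetric] algebra_simps)
    then show ?thesis
      by (simp add: sum_distrib_left power_minus [of "e _"] mult_ac)
  qed
  also have "(e x + e (- x)) * e x = 1 - (- e (2 * x))"
    using e_add [of x x] by (simp add: e_minus distrib_right)
  also have "\<dots> * (\<Sum>k<p. (- e (2 * x)) ^ k) = 1 - (- e (2 * x)) ^ p"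
    by (rule one_diff_power_eq [symmetric])
  also have "e (2 * x) ^ p = 1"
    by (simp add: e_power e_eq_1_iff)
  then have "(- e (2 * x)) ^ p = - 1"
    using assms by (simp add: power_minus_odd)
  finally show ?thesis
    using e_plus_e_minus_neq_0 [OF assms, of x] by (simp add: field_simps)
qed

text \<open>Summing the expansion of the reciprocals over all residues leaves only the frequency
  \<open>2 * k + 1\<close> that p divides, namely k = n. Removing the term 1/2 at x = 0 and halving
  by the symmetry between x and p - x gives the claim.\<close>

lemma sum_inverse_e_plus_e_minus:
  assumes p: "p = 2 * n + 1"
  shows "(\<Sum>a<n. inverse (e (int (Suc a)) + e (- int (Suc a)))) = ((- 1) ^ n * of_nat p - 1) / 4"
proof -
  let ?f = "\<lambda>x. inverse (e x + e (- x))"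
  define S where "S = (\<Sum>a<n. ?f (int (Suc a)))"
  have "odd p"
    using p by simp
  have dvd_iff: "int p dvd 2 * int k + 1 \<longleftrightarrow> k = n" if "k < p" for k
  proof
    assume "int p dvd 2 * int k + 1"
    then have "p dvd 2 * k + 1"
      by presburger
    then obtain c where c: "2 * k + 1 = p * c"
      by (elim dvdE)
    with that have "p * c < p * 2"
      by linarith
    then have "c < 2"
      by (metis mult_less_cancel1)
    with c have "c = 1"
      by (cases c) auto
    with c p show "k = n"
      by simp
  qed (simp add: p add.commute)
  have "(\<Sum>x\<in>{0..<int p}. ?f x) =
      (\<Sum>k<p. (- 1) ^ k * (\<Sum>x\<in>{0..<int p}. e ((2 * int k + 1) * x))) / 2"
    by (simp add: inverse_e_plus_e_minus [OF \<open>odd p\<close>] sum_divide_distrib [symmetric] sum_distrib_left)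
      (rule sum.swap)
  also have "\<dots> = (\<Sum>k<p. if k = n then (- 1) ^ n * of_nat p else 0) / 2"
    by (intro arg_cong2 [where f = "(/)"] sum.cong) (auto simp: sum_e dvd_iff)
  also have "\<dots> = (- 1) ^ n * of_nat p / 2"
    by (simp add: p)
  finally have "(\<Sum>x\<in>{0..<int p}. ?f x) = (- 1) ^ n * of_nat p / 2" .
  moreover have "{0..<int p} = insert 0 {1..<int p}"
    using p_pos by auto
  then have "(\<Sum>x\<in>{0..<int p}. ?f x) = 1 / 2 + (\<Sum>x\<in>{1..<int p}. ?f x)"
    by simp
  moreover have "(\<Sum>x\<in>{1..<int p}. ?f x) = S + S"
  proof -
    have "?f (int p - x) = ?f x" for x
      using e_mod [of "int p - x"] e_mod [of "x - int p"] e_mod [of x] e_mod [of "- x"]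
      by (simp add: add.commute)
    moreover have "(\<Sum>x\<in>{1..<int p}. ?f x) = (\<Sum>a<n. ?f (int (Suc a)) + ?f (int p - int (Suc a)))"
      unfolding p by (rule sum_fold_half)
    ultimately show ?thesis
      by (simp only: S_def sum.distrib)
  qed
  ultimately show ?thesis
    unfolding S_def [symmetric] by (simp add: field_simps)
qed

text \<open>The difference \<open>?s\<close> satisfies a doubling formula with factor
  \<open>?f\<close>, and doubling permutes the nonzero residues, so the full product of
  \<open>?f\<close> is 1. Folding it makes it a square; the sign is settled later from an explicit
  \<open>e\<close>.\<close>

lemma prod_e_plus_e_minus_square:
  assumes p: "p = 2 * n + 1"
  shows "(\<Prod>a<n. e (int (Suc a)) + e (- int (Suc a)))\<^sup>2 = 1"
proof -
  let ?f = "\<lambda>x. e x + e (- x)" and ?s = "\<lambda>x. e x - e (- x)"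
  have periodic: "e (- (x mod int p)) = e (- x)" for x
    by (metis e_mod mod_minus_eq)
  have odd: "coprime 2 (int p)"
    by (simp add: p)
  have "(\<Prod>x\<in>{1..<int p}. ?f x) * (\<Prod>x\<in>{1..<int p}. ?s x) = (\<Prod>x\<in>{1..<int p}. ?s (2 * x))"
  proof (subst prod.distrib [symmetric], rule prod.cong [OF refl])
    fix x
    show "?f x * ?s x = ?s (2 * x)"
      using e_add [of x x] e_add [of "- x" "- x"] by (simp add: algebra_simps)
  qed
  also have "\<dots> = (\<Prod>x\<in>{1..<int p}. ?s x)"
    using odd p_pos by (rule prod_scale_periodic) (simp add: e_mod periodic)
  finally have "(\<Prod>x\<in>{1..<int p}. ?f x) * (\<Prod>x\<in>{1..<int p}. ?s x) = (\<Prod>x\<in>{1..<int p}. ?s x)" .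
  moreover have "?s x \<noteq> 0" if "x \<in> {1..<int p}" for x
  proof
    assume "?s x = 0"
    then have "e (2 * x) = 1"
      using e_add [of x x] by (simp add: e_minus field_simps)
    then have "int p dvd x"
      using odd by (simp add: e_eq_1_iff coprime_commute coprime_dvd_mult_right_iff)
    with that show False
      using not_dvd_of_mem by blast
  qed
  then have "(\<Prod>x\<in>{1..<int p}. ?s x) \<noteq> 0"
    by simp
  ultimately have "(\<Prod>x\<in>{1..<int p}. ?f x) = 1"
    by simp
  moreover have "(\<Prod>x\<in>{1..<int p}. ?f x) = (\<Prod>a<n. ?f (int (Suc a)) * ?f (int (Suc a)))"
  proof -
    have "?f (int p - x) = ?f x" for x
      using e_mod [of "int p - x"] e_mod [of "x - int p"] e_mod [of x] e_mod [of "- x"]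
      by (simp add: add.commute)
    moreover have "(\<Prod>x\<in>{1..<int p}. ?f x) = (\<Prod>a<n. ?f (int (Suc a)) * ?f (int p - int (Suc a)))"
      unfolding p by (rule prod_fold_half)
    ultimately show ?thesis
      by (simp only:)
  qed
  ultimately show ?thesis
    by (simp add: power2_eq_square prod.distrib del: of_nat_Suc)
qed

lemma gauss_sum_even:
  assumes p: "p = 2 * n + 1" and \<alpha>: "mult_char p \<alpha>" and even: "\<alpha> (- 1) = 1"
  shows "gauss_sum \<alpha> = (\<Sum>a<n. \<alpha> (int (Suc a)) * (e (int (Suc a)) + e (- int (Suc a))))"
proof -
  have "\<alpha> (int p - x) = \<alpha> x" for x
    using \<alpha> even by (rule mult_char_reflect)
  moreover have "e (int p - x) = e (- x)" for x
    using e_mod [of "int p - x"] e_mod [of "- x"] by simp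
  moreover have "gauss_sum \<alpha> = (\<Sum>a<n. \<alpha> (int (Suc a)) * e (int (Suc a)) +
      \<alpha> (int p - int (Suc a)) * e (int p - int (Suc a)))"
    unfolding gauss_sum_eq_nonzero [OF \<alpha>] unfolding p by (rule sum_fold_half)
  ultimately show ?thesis
    by (simp only: distrib_left)
qed

text \<open>Here \<open>order\<close> says that X has exact order p - 1. The product of the weights
  stays unevaluated, since so far only its square is known; the factor \<open>of_nat (Suc m)\<close>
  on the left comes from \<open>det_weighted_gram\<close>.\<close>

lemma det_jacobi_matrix:
  assumes p: "p = 2 * Suc m + 1" and X: "mult_char p X"
    and order: "\<And>k. 0 < k \<Longrightarrow> k < p - 1 \<Longrightarrow> \<exists>u. \<not> int p dvd u \<and> X u ^ k \<noteq> 1"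
  shows "of_nat (Suc m) * det (mat m m (\<lambda>(i, j).
             \<Sum>x\<in>{0..<int p}. X x ^ (2 * (i + 1)) * X (1 - x) ^ (2 * (j + 1)))) =
           (- 1) ^ (m * (m - 1) div 2) * of_nat (Suc m) ^ m *
           (\<Prod>a<Suc m. e (int (Suc a)) + e (- int (Suc a))) *
           (((- 1) ^ Suc m * of_nat p - 1) / 4)"
proof -
  let ?n = "Suc m"
  have X1: "X 1 = 1"
    using X prime by (rule mult_char_1)
  have period: "X u ^ k = X u ^ (k mod (2 * ?n))" if "\<not> int p dvd u" for u k
  proof -
    have "X u ^ (2 * ?n) = 1"
      using mult_char_order [OF X prime that] p by simp
    then have "X u ^ (k mod (2 * ?n) + 2 * ?n * (k div (2 * ?n))) = X u ^ (k mod (2 * ?n))"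
      by (simp only: power_add power_mult power_one mult_1_right)
    then show ?thesis
      by (simp only: mod_mult_div_eq)
  qed
  have even: "X (- 1) ^ (2 * k) = 1" for k
    using mult_char_mult [OF X, of "- 1" "- 1"] X1 by (simp add: power_mult power2_eq_square)
  have ev: "mult_char p (\<lambda>x. X x ^ (2 * Suc k))" for k
    using X by (rule mult_char_power) simp
  \<comment> \<open>Since p - 1 is \<open>2 * ?n\<close>, reducing the exponent \<open>2 * k\<close>
    modulo p - 1 puts it into the range of \<open>order\<close>.\<close>
  have nontrivial: "\<exists>u. \<not> int p dvd u \<and> X u ^ (2 * k) \<noteq> 1" if k: "\<not> ?n dvd k" for k
  proof -
    have "2 * k mod (2 * ?n) = 2 * (k mod ?n)"
      by (simp only: mult_mod_right)
    moreover have "k mod ?n > 0"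
      using k by (simp only: mod_greater_zero_iff_not_dvd not_False_eq_True)
    ultimately have "2 * k mod (2 * ?n) > 0" "2 * k mod (2 * ?n) < 2 * ?n"
      by (simp_all only: mod_less_divisor mult_less_mono2 mult_pos_pos zero_less_Suc zero_less_numeral)
    then have "2 * k mod (2 * ?n) > 0" "2 * k mod (2 * ?n) < p - 1"
      by (simp_all only: p add_diff_cancel_right')
    then obtain u where "\<not> int p dvd u" "X u ^ (2 * k mod (2 * ?n)) \<noteq> 1"
      using order by blast
    then show ?thesis
      using period by metis
  qed
  have sum0: "(\<Sum>x\<in>{0..<int p}. X x ^ (2 * Suc k)) = 0" if "\<not> ?n dvd Suc k" for k
    using nontrivial [OF that] ev [of k] prime sum_mult_char_eq_0 by blast
  have nz: "X (int (Suc a)) \<noteq> 0" if "a < ?n" for a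
    using that p by (auto simp: mult_char_eq_0_iff [OF X] dest: zdvd_imp_le)

  define w where "w i a = inverse (X (int (Suc a)) ^ (2 * i))" for i a
  define \<theta> where "\<theta> a = e (int (Suc a)) + e (- int (Suc a))" for a
  define g where "g i = gauss_sum (\<lambda>x. X x ^ (2 * Suc i))" for i
  define F where "F i j = gauss_sum (\<lambda>x. inverse (X x ^ (2 * Suc i) * X x ^ (2 * Suc j)))" for i j

  \<comment> \<open>The division by p is attached to the row factor, so that the entry has the form
    row factor times column factor times \<open>F i j\<close>.\<close>
  have "(\<Sum>x\<in>{0..<int p}. X x ^ (2 * (i + 1)) * X (1 - x) ^ (2 * (j + 1))) =
      g i / of_nat p * g j * F i j" if "i < m" "j < m" for i j
  proof -
    have "\<not> ?n dvd Suc i" "\<not> ?n dvd Suc j"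
      using that by (auto dest: dvd_imp_le)
    then have "g i * g j * F i j = of_nat p *
        (\<Sum>x\<in>{0..<int p}. X x ^ (2 * Suc i) * X (1 - x) ^ (2 * Suc j))"
      unfolding g_def F_def by (intro gauss_sum_triple ev sum0 even)
    with p_pos show ?thesis
      by (simp add: field_simps)
  qed
  then have "mat m m (\<lambda>(i, j). \<Sum>x\<in>{0..<int p}. X x ^ (2 * (i + 1)) * X (1 - x) ^ (2 * (j + 1))) =
      mat m m (\<lambda>(i, j). g i / of_nat p * g j * F i j)"
    by (intro eq_matI) simp_all
  then have "det (mat m m (\<lambda>(i, j).
        \<Sum>x\<in>{0..<int p}. X x ^ (2 * (i + 1)) * X (1 - x) ^ (2 * (j + 1)))) =
      (\<Prod>i<m. g i / of_nat p) * (\<Prod>j<m. g j) * det (mat m m (\<lambda>(i, j). F i j))"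
    by (simp only: det_mat_scale_rows_cols)
  also have "(\<Prod>i<m. g i / of_nat p) * (\<Prod>j<m. g j) = 1"
  proof -
    \<comment> \<open>The exponents of these two characters add up to \<open>2 * ?n\<close>, so the
      characters are inverse to each other. Reversing the order of one product then cancels all the
      factors p.\<close>
    have "g i * g (m - Suc i) = of_nat p" if "i < m" for i
    proof -
      have "X x ^ (2 * Suc (m - Suc i)) = inverse (X x ^ (2 * Suc i))" for x
      proof (cases "int p dvd x")
        case True
        then have "X x = 0"
          by (simp add: mult_char_eq_0_iff [OF X])
        then show ?thesis
          by simp
      next
        case False
        have "2 * Suc (m - Suc i) + 2 * Suc i = 2 * ?n"
          using that by simp
        then have "X x ^ (2 * Suc (m - Suc i)) * X x ^ (2 * Suc i) = X x ^ (2 * ?n)"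
          by (simp only: power_add [symmetric])
        also have "\<dots> = 1"
          using period [OF False, of "2 * ?n"] by simp
        finally show ?thesis
          by (metis inverse_unique mult.commute)
      qed
      then have "g i * g (m - Suc i) =
          gauss_sum (\<lambda>x. X x ^ (2 * Suc i)) * gauss_sum (\<lambda>x. inverse (X x ^ (2 * Suc i)))"
        by (simp only: g_def)
      also have "\<dots> = of_nat p * X (- 1) ^ (2 * Suc i)"
        using that by (intro gauss_sum_times_inverse ev sum0) (auto dest: dvd_imp_le)
      finally show ?thesis
        by (simp only: even mult_1_right)
    qed
    then have "(\<Prod>i<m. g i * g (m - Suc i)) = (\<Prod>i<m. of_nat p)"
      by (intro prod.cong) auto
    then show ?thesis
      using p_pos prod.nat_diff_reindex [of g m] by (simp add: prod.distrib prod_dividef)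
  qed
  also have "mat m m (\<lambda>(i, j). F i j) =
      mat m m (\<lambda>(i, j). \<Sum>a<?n. w (Suc i) a * w (Suc j) a * \<theta> a)"
  proof -
    have "F i j = (\<Sum>a<?n. w (Suc i) a * w (Suc j) a * \<theta> a)" for i j
      unfolding F_def w_def \<theta>_def inverse_mult_distrib [symmetric]
      by (intro gauss_sum_even p mult_char_inverse mult_char_prod ev) (simp only: even inverse_1 mult_1)
    then show ?thesis
      by simp
  qed
  finally have "of_nat ?n * det (mat m m (\<lambda>(i, j).
        \<Sum>x\<in>{0..<int p}. X x ^ (2 * (i + 1)) * X (1 - x) ^ (2 * (j + 1)))) =
      of_nat ?n * det (mat m m (\<lambda>(i, j). \<Sum>a<?n. w (Suc i) a * w (Suc j) a * \<theta> a))"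
    by simp
  also have "\<dots> = (- 1) ^ (m * (m - 1) div 2) * of_nat ?n ^ m *
      (\<Prod>a<?n. \<theta> a) * (\<Sum>a<?n. inverse (\<theta> a))"
  proof (rule det_weighted_gram)
    \<comment> \<open>Orthogonality on half of the residues: these characters are even, so the half
      sum is half of the full sum.\<close>
    show "(\<Sum>a<?n. w i a * w j a) = (if ?n dvd i + j then of_nat ?n else 0)"
      if "i < ?n" "j < ?n" for i j
    proof -
      have ww: "w i a * w j a = inverse (X (int (Suc a)) ^ (2 * (i + j)))" for a
        by (simp add: w_def power_add distrib_left)
      show ?thesis
      proof (cases "?n dvd i + j")
        case True
        then have "2 * (i + j) mod (2 * ?n) = 0"
          by (simp only: mult_mod_right [symmetric] dvd_imp_mod_0 mult_0_right)
        then have "X (int (Suc a)) ^ (2 * (i + j)) = 1" if "a < ?n" for a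
          using period [of "int (Suc a)" "2 * (i + j)"] nz [OF that]
          by (simp only: mult_char_eq_0_iff [OF X] not_False_eq_True power_0)
        with True show ?thesis
          by (simp add: ww del: of_nat_Suc sum.lessThan_Suc)
      next
        case False
        \<comment> \<open>\<open>False\<close> excludes \<open>i + j = 0\<close>, and a positive
          exponent is what \<open>ev\<close> and \<open>nontrivial\<close> are applied to.\<close>
        then obtain k where k: "i + j = Suc k"
          by (cases "i + j") auto
        define f where "f = (\<lambda>x. inverse (X x ^ (2 * Suc k)))"
        obtain u where "\<not> int p dvd u" "X u ^ (2 * Suc k) \<noteq> 1"
          using nontrivial False unfolding k by metis
        then have "f u \<noteq> 1"
          unfolding f_def by (metis inverse_1 inverse_inverse_eq)
        have f: "mult_char p f"
          unfolding f_def by (intro mult_char_inverse ev)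
        have "f (int p - x) = f x" for x
          using f by (rule mult_char_reflect) (simp only: f_def even inverse_1)
        moreover have "(\<Sum>x\<in>{1..<int p}. f x) = (\<Sum>a<?n. f (int (Suc a)) + f (int p - int (Suc a)))"
          unfolding p by (rule sum_fold_half)
        moreover have "(\<Sum>x\<in>{1..<int p}. f x) = 0"
          using sum_mult_char_eq_0 [OF f prime \<open>\<not> int p dvd u\<close> \<open>f u \<noteq> 1\<close>]
          by (simp only: sum_mult_char_eq_sum_nonzero [OF f p_pos])
        ultimately have "2 * (\<Sum>a<?n. f (int (Suc a))) = 0"
          by (simp only: sum.distrib mult_2)
        then have "(\<Sum>a<?n. f (int (Suc a))) = 0"
          by (simp only: mult_eq_0_iff) simp
        with False show ?thesis
          by (simp only: ww k f_def if_False)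
      qed
    qed
    show "w 0 a = 1" for a
      by (simp add: w_def)
    show "\<theta> a \<noteq> 0" for a
      unfolding \<theta>_def using p by (intro e_plus_e_minus_neq_0) simp
  qed
  also have "(\<Sum>a<?n. inverse (\<theta> a)) = ((- 1) ^ ?n * of_nat p - 1) / 4"
    unfolding \<theta>_def using p by (rule sum_inverse_e_plus_e_minus)
  finally show ?thesis
    by (simp only: \<theta>_def)
qed

end

section \<open>The root of unity\<close>

text \<open>The root of unity \<open>- cis (pi / p)\<close> is used instead of \<open>cis (2 * pi / p)\<close> because then
  \<open>e a + e (- a)\<close> is \<open>(- 1) ^ a * 2 * cos (pi * a / p)\<close>, whose sign for \<open>a < p / 2\<close> is
  evident.\<close>

definition half_turn_char :: "nat \<Rightarrow> int \<Rightarrow> complex" where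
  "half_turn_char p x = cis (pi * of_int ((int p + 1) * x) / of_nat p)"

text \<open>As p + 1 is even, the angle is 2 pi / p times (p + 1) / 2 times x, and (p + 1) / 2 is a
  unit modulo p.\<close>

lemma additive_char_half_turn:
  assumes "prime p" "odd p"
  shows "additive_char p (half_turn_char p)"
proof
  show "half_turn_char p (x + y) = half_turn_char p x * half_turn_char p y" for x y
    by (simp add: half_turn_char_def cis_mult add_divide_distrib [symmetric] algebra_simps)
  have p0: "p > 0"
    using assms(1) by (rule prime_gt_0_nat)
  show "half_turn_char p x = 1 \<longleftrightarrow> int p dvd x" for x
  proof
    assume "half_turn_char p x = 1"
    then have "cos (pi * of_int ((int p + 1) * x) / of_nat p) = 1"
      by (simp add: half_turn_char_def complex_eq_iff)
    then obtain j :: int where "pi * of_int ((int p + 1) * x) / of_nat p = of_int j * 2 * pi"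
      by (auto simp only: cos_one_2pi_int)
    then have "pi * real_of_int ((int p + 1) * x) = pi * of_int (j * 2 * int p)"
      using p0 by (simp add: field_simps)
    then have "(int p + 1) * x = j * 2 * int p"
      by (simp only: mult_cancel_left of_int_eq_iff pi_neq_zero simp_thms)
    then have "x = int p * (2 * j - x)"
      by (simp add: algebra_simps)
    then show "int p dvd x"
      by (rule dvdI)
  next
    assume "int p dvd x"
    then obtain c where c: "x = int p * c"
      by (elim dvdE)
    obtain k where k: "int p + 1 = 2 * k"
      using assms(2) by (metis even_of_nat dvdE odd_even_add odd_one)
    have "pi * of_int ((int p + 1) * x) / of_nat p = 2 * pi * of_int (k * c)"
      unfolding k c using p0 by simp
    then show "half_turn_char p x = 1"
      unfolding half_turn_char_def by (simp only: cis_multiple_2pi Ints_of_int)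
  qed
qed fact

text \<open>The signs \<open>(- 1) ^ Suc a\<close> multiply to the right-hand side. The remaining
  product \<open>C\<close> of cosines is positive and has square 1, so it equals 1.\<close>

lemma prod_half_turn_char:
  assumes "prime p" and p: "p = 2 * n + 1"
  shows "(\<Prod>a<n. half_turn_char p (int (Suc a)) + half_turn_char p (- int (Suc a))) =
           (- 1) ^ (n * (n + 1) div 2)"
proof -
  interpret additive_char p "half_turn_char p"
    using assms by (intro additive_char_half_turn) auto
  define C where "C = (\<Prod>a<n. 2 * cos (pi * real (Suc a) / real p))"
  have "cis y + cis (- y) = of_real (2 * cos y)" for y
    by (simp add: complex_eq_iff)
  moreover have "cos (pi * real_of_int ((int p + 1) * int (Suc a)) / real p) =
      (- 1) ^ Suc a * cos (pi * real (Suc a) / real p)" for a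
  proof -
    have "pi * real_of_int ((int p + 1) * int (Suc a)) / real p =
        real (Suc a) * pi + pi * real (Suc a) / real p"
      using p_pos by (simp add: field_simps)
    then show ?thesis
      by (simp only: cos_add cos_npi sin_npi mult_zero_left diff_0_right)
  qed
  ultimately have "half_turn_char p (int (Suc a)) + half_turn_char p (- int (Suc a)) =
      of_real ((- 1) ^ Suc a * (2 * cos (pi * real (Suc a) / real p)))" for a
    unfolding half_turn_char_def by (simp only: mult_minus_right of_int_minus minus_divide_left [symmetric] mult.left_commute)
  then have prod: "(\<Prod>a<n. half_turn_char p (int (Suc a)) + half_turn_char p (- int (Suc a))) =
      of_real ((\<Prod>a<n. (- 1) ^ Suc a) * C)"
    by (simp only: C_def of_real_prod prod.distrib [symmetric])
  have sign: "(\<Prod>a<n. (- 1 :: real) ^ Suc a) = (- 1) ^ (n * (n + 1) div 2)" for n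
  proof (induction n)
    case (Suc n)
    have "n * (n + 1) div 2 + Suc n = Suc n * (Suc n + 1) div 2"
      by simp
    with Suc show ?case
      by (simp only: prod.lessThan_Suc power_add [symmetric])
  qed simp
  have "C > 0"
    unfolding C_def
  proof (intro prod_pos ballI mult_pos_pos cos_gt_zero)
    fix a assume "a \<in> {..<n}"
    \<comment> \<open>\<open>Suc a\<close> is at most n, which is below p / 2, so each cosine is
      taken in the first quadrant.\<close>
    then have "real (Suc a) / real p < 1 / 2"
      using p by (simp add: field_simps)
    then show "pi * real (Suc a) / real p < pi / 2"
      using mult_strict_left_mono [of "real (Suc a) / real p" "1 / 2" pi] by simp
  qed (use p_pos in auto)
  moreover have "C\<^sup>2 = 1"
  proof -
    have "of_real (((- 1) ^ (n * (n + 1) div 2) * C)\<^sup>2) = (of_real 1 :: complex)"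
      using prod_e_plus_e_minus_square [OF p] by (simp only: prod sign of_real_power of_real_1)
    then have "((- 1) ^ (n * (n + 1) div 2) * C)\<^sup>2 = 1"
      by (simp only: of_real_eq_iff)
    then show ?thesis
      by (simp add: power_mult_distrib flip: power_mult)
  qed
  ultimately have "C = 1"
    by (simp add: power2_eq_1_iff)
  then show ?thesis
    unfolding prod sign by simp
qed

section \<open>The character group\<close>

lemma carrier_mult_of_Fp: "prime p \<Longrightarrow> carrier (mult_of (Fp p)) = {1..<int p}"
  by (auto simp: residue_ring_def)

lemma char_group_carrier_iff:
  assumes "prime p"
  shows "\<psi> \<in> carrier (char_group p) \<longleftrightarrow>
    (\<forall>x\<in>{1..<int p}. \<psi> x \<noteq> 0) \<and> (\<forall>x. x \<notin> {1..<int p} \<longrightarrow> \<psi> x = 0) \<and>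
    (\<forall>x\<in>{1..<int p}. \<forall>y\<in>{1..<int p}. \<psi> (x * y mod int p) = \<psi> x * \<psi> y)"
proof -
  have "x \<otimes>\<^bsub>Fp p\<^esub> y = x * y mod int p" for x y
    by (simp add: residue_ring_def)
  then show ?thesis
    unfolding char_group_def hom_def complex_units_def partial_object.simps monoid.simps
      mult_mult_of carrier_mult_of_Fp [OF assms]
    by (auto simp: Pi_iff)
qed

text \<open>For k = 0 the two sides would differ away from the nonzero residues, where the group
  unit is 0 but \<open>\<psi> x ^ 0\<close> is 1.\<close>

lemma char_group_nat_pow:
  assumes "prime p" "\<psi> \<in> carrier (char_group p)" "k > 0"
  shows "\<psi> [^]\<^bsub>char_group p\<^esub> (k :: nat) = (\<lambda>x. \<psi> x ^ k)"
proof -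
  interpret comm_group "char_group p"
    using assms(1) by (rule comm_group_char_group)
  show ?thesis
    using \<open>k > 0\<close>
  proof (induction k rule: nat_induct_non_zero)
    case 1
    then show ?case
      using assms(2) by simp
  next
    case (Suc k)
    then show ?case
      by (simp add: char_group_def mult.commute fun_eq_iff)
  qed
qed

lemma mult_char_of_char_group:
  assumes "prime p" "\<psi> \<in> carrier (char_group p)"
  shows "mult_char p (\<lambda>x. \<psi> (x mod int p))"
proof -
  have p0: "int p > 0"
    using assms(1) by (simp add: prime_gt_0_nat)
  have mem: "x mod int p \<in> {1..<int p} \<longleftrightarrow> \<not> int p dvd x" for x
    using pos_mod_bound [OF p0, of x] pos_mod_sign [OF p0, of x]
    by (auto simp: dvd_eq_mod_eq_0)
  have zero: "\<psi> (x mod int p) = 0 \<longleftrightarrow> int p dvd x" for x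
    using assms(2) mem [of x] unfolding char_group_carrier_iff [OF assms(1)] by metis
  have "\<psi> (x * y mod int p) = \<psi> (x mod int p) * \<psi> (y mod int p)" for x y
  proof (cases "int p dvd x \<or> int p dvd y")
    case True
    then have "int p dvd x * y"
      by auto
    with True show ?thesis
      using zero by (metis mult_zero_left mult_zero_right)
  next
    case False
    then have "x mod int p \<in> {1..<int p}" "y mod int p \<in> {1..<int p}"
      by (simp_all only: mem not_False_eq_True de_Morgan_disj)
    then have "\<psi> ((x mod int p) * (y mod int p) mod int p) = \<psi> (x mod int p) * \<psi> (y mod int p)"
      using assms(2) unfolding char_group_carrier_iff [OF assms(1)] by blast
    then show ?thesis
      by (simp only: mod_mult_eq)
  qed
  with zero show ?thesis
    by (simp add: mult_char_def)
qed

text \<open>Send a primitive root g to a primitive (p - 1)-th root of unity. This character detects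
  the full order p - 1 and thereby bounds the order of any generator from below.\<close>

lemma char_group_faithful_element:
  assumes "prime p"
  shows "\<exists>\<psi>\<in>carrier (char_group p). \<exists>g\<in>{1..<int p}. \<forall>k. \<psi> g ^ k = 1 \<longrightarrow> p - 1 dvd k"
proof -
  obtain g where g: "residue_primroot p g"
    using prime_primitive_root_exists [of p] assms prime_gt_1_nat [of p] by auto
  have p1: "p > 1"
    using assms by (rule prime_gt_1_nat)
  define N where "N = p - 1"
  have "N > 0"
    using p1 by (simp add: N_def)
  have ord: "ord p g = N" "coprime p g"
    using g assms by (auto simp: residue_primroot_def totient_prime N_def)
  \<comment> \<open>A discrete logarithm to the base g. It is determined only modulo
    \<open>N\<close>; \<open>\<zeta>_eq\<close> below makes the choice harmless.\<close>
  define ind where "ind x = (SOME i. int (g ^ i mod p) = x)" for x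
  have ex: "\<exists>i. int (g ^ i mod p) = x" if "x \<in> {1..<int p}" for x
  proof -
    have "nat x \<in> totatives p"
      using that assms by (auto simp: totatives_prime)
    then have "nat x \<in> (\<lambda>i. g ^ i mod p) ` {..<totient p}"
      using residue_primroot_is_generator [OF p1 g] by (simp add: bij_betw_def)
    then obtain i where i: "nat x = g ^ i mod p"
      by blast
    have "int (g ^ i mod p) = x"
      using that unfolding i [symmetric] by simp
    then show ?thesis ..
  qed
  have ind: "int (g ^ ind x mod p) = x" if "x \<in> {1..<int p}" for x
    unfolding ind_def using ex [OF that] by (rule someI_ex)
  define \<zeta> where "\<zeta> = cis (2 * pi / real N)"
  have \<zeta>: "\<zeta> ^ k = 1 \<longleftrightarrow> N dvd k" for k
  proof
    assume "\<zeta> ^ k = 1"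
    then have "cos (real k * (2 * pi / real N)) = 1"
      by (simp add: \<zeta>_def DeMoivre complex_eq_iff)
    then obtain j :: int where "real k * (2 * pi / real N) = of_int j * 2 * pi"
      by (auto simp only: cos_one_2pi_int)
    then have "real_of_int (int k) = real_of_int (j * int N)"
      using \<open>N > 0\<close> by (simp add: field_simps)
    then have "int k = j * int N"
      by (simp only: of_int_eq_iff)
    then show "N dvd k"
      by (metis dvd_triv_right int_dvd_int_iff)
  next
    assume "N dvd k"
    then obtain c where "k = N * c"
      by (elim dvdE)
    then have "real k * (2 * pi / real N) = 2 * pi * of_int (int c)"
      using \<open>N > 0\<close> by simp
    then show "\<zeta> ^ k = 1"
      unfolding \<zeta>_def DeMoivre by (simp only: cis_multiple_2pi Ints_of_int)
  qed
  have \<zeta>_eq: "\<zeta> ^ i = \<zeta> ^ j" if "g ^ i mod p = g ^ j mod p" for i j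
  proof -
    have "i mod N = j mod N"
      using that order_divides_expdiff [OF ord(2), of i j] ord(1) by (simp add: cong_def)
    moreover have "\<zeta> ^ k = \<zeta> ^ (k mod N)" for k
    proof -
      have "\<zeta> ^ N = 1"
        by (simp add: \<zeta>)
      then have "\<zeta> ^ (k mod N + N * (k div N)) = \<zeta> ^ (k mod N)"
        by (simp only: power_add power_mult power_one mult_1_right)
      then show ?thesis
        by (simp only: mod_mult_div_eq)
    qed
    from this [of i] this [of j] calculation show ?thesis
      by simp
  qed
  define \<psi> where "\<psi> x = (if x \<in> {1..<int p} then \<zeta> ^ ind x else 0)" for x
  have g_power: "int (g ^ i mod p) \<in> {1..<int p}" for i
  proof -
    have "coprime p (g ^ i)"
      using ord(2) by simp
    then have "\<not> p dvd g ^ i"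
      using p1 by (metis coprime_absorb_left nat_dvd_1_iff_1 nat_neq_iff)
    then show ?thesis
      using p1 by (auto simp: dvd_eq_mod_eq_0)
  qed
  have \<psi>: "\<psi> (int (g ^ i mod p)) = \<zeta> ^ i" for i
    using g_power [of i] ind [OF g_power [of i]] \<zeta>_eq [of "ind (int (g ^ i mod p))" i]
    unfolding \<psi>_def by (simp only: if_True of_nat_eq_iff)
  have "\<psi> \<in> carrier (char_group p)"
    unfolding char_group_carrier_iff [OF assms]
  proof (intro conjI ballI)
    fix x y assume xy: "x \<in> {1..<int p}" "y \<in> {1..<int p}"
    have "x * y mod int p = int (g ^ (ind x + ind y) mod p)"
      using ind [OF xy(1)] ind [OF xy(2)]
      by (metis mod_mult_eq of_nat_mod of_nat_mult power_add)
    then have "\<psi> (x * y mod int p) = \<zeta> ^ (ind x + ind y)"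
      by (simp only: \<psi>)
    with xy show "\<psi> (x * y mod int p) = \<psi> x * \<psi> y"
      by (simp add: \<psi>_def power_add)
  qed (auto simp: \<psi>_def \<zeta>_def)
  moreover have "int (g mod p) \<in> {1..<int p}"
    using g_power [of 1] by simp
  moreover have "p - 1 dvd k" if "\<psi> (int (g mod p)) ^ k = 1" for k
    using that \<psi> [of 1] \<zeta> [of k] by (simp add: N_def)
  ultimately show ?thesis
    by blast
qed

text \<open>If the k-th power of \<open>\<chi>\<close> were trivial, so would be that of every
  generated character, including the faithful one, which forces p - 1 to divide k.\<close>

lemma char_group_generator_order:
  assumes "prime p" "\<chi> \<in> carrier (char_group p)"
    and gen: "generate (char_group p) {\<chi>} = carrier (char_group p)"
    and k: "0 < k" "k < p - 1"
  shows "\<exists>u\<in>{1..<int p}. \<chi> u ^ k \<noteq> 1"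
proof (rule ccontr)
  interpret comm_group "char_group p"
    using assms(1) by (rule comm_group_char_group)
  assume "\<not> ?thesis"
  then have 1: "\<chi> u ^ k = 1" if "u \<in> {1..<int p}" for u
    using that by blast
  have mult: "(\<phi> \<otimes>\<^bsub>char_group p\<^esub> \<psi>) u = \<phi> u * \<psi> u" for \<phi> \<psi> u
    by (simp add: char_group_def)
  have one: "\<one>\<^bsub>char_group p\<^esub> u = 1" if "u \<in> {1..<int p}" for u
    using that carrier_mult_of_Fp [OF assms(1)] by (simp add: char_group_def)
  have all: "\<psi> u ^ k = 1" if "\<psi> \<in> generate (char_group p) {\<chi>}" "u \<in> {1..<int p}" for \<psi> u
    using that
  proof (induction)
    case (inv h)
    \<comment> \<open>The group inverse is known only through its law; evaluated at u, this law
      gives the k-th power of its value.\<close>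
    then have "(inv\<^bsub>char_group p\<^esub> \<chi> \<otimes>\<^bsub>char_group p\<^esub> \<chi>) u = 1"
      using assms(2) one by simp
    with inv 1 show ?case
      by (metis mult mult_1_right power_mult_distrib power_one singletonD)
  qed (simp_all add: 1 one mult power_mult_distrib)
  obtain \<psi> g where "\<psi> \<in> carrier (char_group p)" "g \<in> {1..<int p}" "\<psi> g ^ k = 1 \<longrightarrow> p - 1 dvd k"
    using char_group_faithful_element [OF assms(1)] by blast
  then have "p - 1 dvd k"
    using all gen by blast
  with k show False
    by (auto dest: dvd_imp_le)
qed

lemma jacobi_sum_eq:
  assumes "prime p"
  shows "jacobi_sum p \<phi> \<psi> = (\<Sum>x\<in>{0..<int p}. \<phi> x * \<psi> ((1 - x) mod int p))"
proof -
  interpret residues_prime p "Fp p"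
    using assms by unfold_locales auto
  have "\<one>\<^bsub>Fp p\<^esub> \<ominus>\<^bsub>Fp p\<^esub> x = (1 - x) mod int p" for x
    by (simp add: a_minus_def res_neg_eq res_add_eq res_one_eq mod_simps)
  moreover have "carrier (Fp p) = {0..<int p}"
    by (auto simp: residue_ring_def)
  ultimately show ?thesis
    by (simp add: jacobi_sum_def)
qed

theorem theorem1p3:
  fixes p :: nat and \<chi> :: "int \<Rightarrow> complex"
  assumes "prime p" and "p \<ge> 5"
    and "\<chi> \<in> carrier (char_group p)"
    and "generate (char_group p) {\<chi>} = carrier (char_group p)"
  shows "det (mat ((p - 3) div 2) ((p - 3) div 2)
           (\<lambda>(i, j). jacobi_sum p (\<chi> [^]\<^bsub>char_group p\<^esub> (2 * (i + 1)))
                                 (\<chi> [^]\<^bsub>char_group p\<^esub> (2 * (j + 1)))))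
       = (1 + (- 1) ^ ((p + 1) div 2) * of_nat p) / 4
         * ((of_nat p - 1) / 2) ^ ((p - 5) div 2)"
proof -
  have "odd p"
    using assms(1,2) prime_odd_nat by simp
  \<comment> \<open>The matrix has size m = l + 1, so \<open>of_nat (Suc m) ^ m\<close> splits off
    the one factor that is cancelled at the end.\<close>
  define l where "l = (p - 5) div 2"
  define m where "m = Suc l"
  have p: "p = 2 * Suc m + 1"
    using \<open>odd p\<close> assms(2) unfolding m_def l_def by presburger
  interpret additive_char p "half_turn_char p"
    using assms(1) \<open>odd p\<close> by (rule additive_char_half_turn)
  define X where "X x = \<chi> (x mod int p)" for x
  have X: "mult_char p X"
    unfolding X_def using assms(1,3) by (rule mult_char_of_char_group)
  let ?M = "mat m m (\<lambda>(i, j). \<Sum>x\<in>{0..<int p}. X x ^ (2 * (i + 1)) * X (1 - x) ^ (2 * (j + 1)))"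
  have "jacobi_sum p (\<chi> [^]\<^bsub>char_group p\<^esub> (2 * (i + 1))) (\<chi> [^]\<^bsub>char_group p\<^esub> (2 * (j + 1))) =
      (\<Sum>x\<in>{0..<int p}. X x ^ (2 * (i + 1)) * X (1 - x) ^ (2 * (j + 1)))" for i j
    using char_group_nat_pow [OF assms(1,3), of "2 * (i + 1)"]
      char_group_nat_pow [OF assms(1,3), of "2 * (j + 1)"]
    by (simp only: jacobi_sum_eq [OF assms(1)] X_def) simp
  moreover have "(p - 3) div 2 = m"
    using p by simp
  ultimately have lhs: "mat ((p - 3) div 2) ((p - 3) div 2)
      (\<lambda>(i, j). jacobi_sum p (\<chi> [^]\<^bsub>char_group p\<^esub> (2 * (i + 1)))
        (\<chi> [^]\<^bsub>char_group p\<^esub> (2 * (j + 1)))) = ?M"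
    by simp
  have "\<exists>u. \<not> int p dvd u \<and> X u ^ k \<noteq> 1" if k: "0 < k" "k < p - 1" for k
  proof -
    obtain u where u: "u \<in> {1..<int p}" "\<chi> u ^ k \<noteq> 1"
      using char_group_generator_order [OF assms(1,3,4) k] by blast
    then show ?thesis
      using not_dvd_of_mem [of u] by (intro exI [of _ u]) (simp add: X_def)
  qed
  from det_jacobi_matrix [OF p X this]
  have "of_nat (Suc m) * det ?M = (- 1) ^ (m * (m - 1) div 2) * of_nat (Suc m) ^ m *
      (- 1) ^ (Suc m * (Suc m + 1) div 2) * (((- 1) ^ Suc m * of_nat p - 1) / 4)"
    by (simp only: prod_half_turn_char [OF assms(1) p])
  also have "(- 1 :: complex) ^ (m * (m - 1) div 2) * of_nat (Suc m) ^ m *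
      (- 1) ^ (Suc m * (Suc m + 1) div 2) = - (of_nat (Suc m) ^ m)"
  proof -
    \<comment> \<open>The anti-diagonal sign and the sign of the product of weights have exponents
      with odd sum, so together they contribute -1. This turns
      \<open>(- 1) ^ Suc m * of_nat p - 1\<close> into the stated numerator.\<close>
    have "m * (m - 1) div 2 + Suc m * (Suc m + 1) div 2 = 2 * (m * (m + 1) div 2) + 1"
    proof -
      have "m * (m - 1) div 2 + m = m * (m + 1) div 2"
        by (cases m) auto
      moreover have "m * (m + 1) div 2 + Suc m = Suc m * (Suc m + 1) div 2"
        by simp
      ultimately show ?thesis
        by linarith
    qed
    then have "(- 1 :: complex) ^ (m * (m - 1) div 2) * (- 1) ^ (Suc m * (Suc m + 1) div 2) = - 1"
      by (simp only: power_add [symmetric]) simp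
    then show ?thesis
      by (simp add: mult_ac)
  qed
  finally have "of_nat (Suc m) * det ?M =
      of_nat (Suc m) * ((1 + (- 1) ^ (Suc m + 1) * of_nat p) / 4 * of_nat (Suc m) ^ l)"
    unfolding m_def by (simp add: field_simps)
  then have "det ?M = (1 + (- 1) ^ (Suc m + 1) * of_nat p) / 4 * of_nat (Suc m) ^ l"
    by (simp only: mult_cancel_left of_nat_eq_0_iff nat.simps simp_thms)
  moreover have "(p + 1) div 2 = Suc m + 1" "(of_nat p - 1) / 2 = (of_nat (Suc m) :: complex)"
    using p by simp_all
  ultimately show ?thesis
    by (simp only: lhs l_def)
qed

end
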